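(* Let $A\in\mathbb{R}^{n\times n}$ be the adjacency matrix of a finite directed weighted graph without loops with positive edge weights ($A_{ij}>0$ if $(i,j)$ is an edge, $A_{ij}=0$ otherwise, $A_{ii}=0$). Let $p_k(A)$ be the matrix whose $(i,j)$ entry is the sum of the weights of all nonbacktracking walks of length $k$ from $i$ to $j$ ($p_0(A)=I$), and let $\Phi(t)=\sum_{k=0}^\infty t^k p_k(A)$. Let $S=A\circ A^T$, $Q=S^{\circ 1/2}$, $f_1(x)=\frac{x}{1-x}$ and $f_2(x)=\frac{x}{1+x}$. Then for all values of $t$ such that the series $\Phi(t)$ converges, \[ \Phi(t) = \Bigl(I + \operatorname{dd}\bigl[f_1(\circ t Q)\, f_2 (\circ t Q)\bigr] - t A \circ/ (\mathbf{1} \mathbf{1}^T-t^2 S) \Bigr)^{-1}. \]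
   Context: A walk of length $\ell$ is a node sequence $i_1,\dots,i_{\ell+1}$ with each $(i_j,i_{j+1})$ an edge; its weight is $\prod_j A_{i_j i_{j+1}}$; it is nonbacktracking if it contains no consecutive subsequence $i\,j\,i$. $\circ$ denotes the elementwise product, $X^{\circ 1/2}$ the elementwise nonnegative square root, $f_i(\circ tX)$ the matrix obtained by applying $f_i$ to each entry of $tX$, and $X\circ/ Y$ elementwise division. The product $f_1(\circ tQ) f_2(\circ tQ)$ is the ordinary matrix product. $\operatorname{dd}(X)$ is the diagonal matrix with the same diagonal as $X$. $\mathbf{1}$ is the all-ones vector.
   Formalization: The theorem additionally assumes 1 − t²S_ij ≠ 0 for all i, j, so that the right-hand side is defined; convergence does not imply this: for two nodes joined by reciprocal edges of weight 1, Φ(t)=I+tA converges for every t, but at t=1 the formula divides by zero. *)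

theory Defs
  imports "HOL-Analysis.Analysis"
begin

text \<open>
  The finite node set is the universe of the index type, and the edges are a set of ordered pairs
  of nodes. A walk \<open>i\<^sub>1, \<dots>, i\<^sub>l\<^sub>+\<^sub>1\<close> of length \<open>l\<close> is represented by the list of its \<open>l + 1\<close> nodes.
\<close>

definition weighted_adjacency :: "('n::finite \<times> 'n) set \<Rightarrow> real^'n^'n \<Rightarrow> bool" where
  "weighted_adjacency E A \<longleftrightarrow>
     (\<forall>i. (i, i) \<notin> E) \<and>
     (\<forall>i j. (i, j) \<in> E \<longrightarrow> A $ i $ j > 0) \<and>
     (\<forall>i j. (i, j) \<notin> E \<longrightarrow> A $ i $ j = 0)"

definition is_walk :: "('n \<times> 'n) set \<Rightarrow> nat \<Rightarrow> 'n list \<Rightarrow> bool" where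
  "is_walk E l w \<longleftrightarrow> length w = Suc l \<and> (\<forall>m<l. (w ! m, w ! Suc m) \<in> E)"

definition nonbacktracking :: "'n list \<Rightarrow> bool" where
  "nonbacktracking w \<longleftrightarrow> \<not> (\<exists>xs ys i j. w = xs @ [i, j, i] @ ys)"

definition walk_weight :: "real^'n^'n \<Rightarrow> 'n list \<Rightarrow> real" where
  "walk_weight A w = (\<Prod>m<length w - 1. A $ (w ! m) $ (w ! Suc m))"

definition nbt_walks :: "('n \<times> 'n) set \<Rightarrow> nat \<Rightarrow> 'n \<Rightarrow> 'n \<Rightarrow> 'n list set" where
  "nbt_walks E k i j = {w. is_walk E k w \<and> nonbacktracking w \<and> hd w = i \<and> last w = j}"

text \<open>
  The node type is finite, so each set of walks of fixed length is finite and the sum below is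
  a genuine one; for \<open>k = 0\<close> it yields the identity matrix, because the only walk of length 0
  from \<open>i\<close> is \<open>[i]\<close>, with the empty product as its weight.
\<close>

definition nbt_matrix :: "('n::finite \<times> 'n) set \<Rightarrow> real^'n^'n \<Rightarrow> nat \<Rightarrow> real^'n^'n" where
  "nbt_matrix E A k = (\<chi> i j. \<Sum>w\<in>nbt_walks E k i j. walk_weight A w)"

definition mscale :: "'a::times \<Rightarrow> 'a^'n::finite^'m::finite \<Rightarrow> 'a^'n^'m" where
  "mscale c X = (\<chi> i j. c * X $ i $ j)"

text \<open>
  The parameter ranges over a complete normed field over the reals, that is, over the real or the
  complex numbers; real matrices are embedded entrywise.
\<close>

definition nbt_term ::
  "('n::finite \<times> 'n) set \<Rightarrow> real^'n^'n \<Rightarrow> 'a::{real_normed_field,banach} \<Rightarrow> nat \<Rightarrow> 'a^'n^'n" where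
  "nbt_term E A t k = mscale (t ^ k) (map_matrix of_real (nbt_matrix E A k))"

definition nbt_gen ::
  "('n::finite \<times> 'n) set \<Rightarrow> real^'n^'n \<Rightarrow> 'a::{real_normed_field,banach} \<Rightarrow> 'a^'n^'n" where
  "nbt_gen E A t = (\<Sum>k. nbt_term E A t k)"

definition hadamard :: "'a::times^'n::finite^'m::finite \<Rightarrow> 'a^'n^'m \<Rightarrow> 'a^'n^'m"
    (infixl \<open>\<circ>\<^sub>H\<close> 70) where
  "X \<circ>\<^sub>H Y = (\<chi> i j. X $ i $ j * Y $ i $ j)"

definition hadamard_div :: "'a::field^'n::finite^'m::finite \<Rightarrow> 'a^'n^'m \<Rightarrow> 'a^'n^'m"
    (infixl \<open>\<oslash>\<^sub>H\<close> 70) where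
  "X \<oslash>\<^sub>H Y = (\<chi> i j. X $ i $ j / Y $ i $ j)"

definition dd :: "'a::zero^'n::finite^'n \<Rightarrow> 'a^'n^'n" where
  "dd X = (\<chi> i j. if i = j then X $ i $ j else 0)"

definition ones_matrix :: "'a::one^'n::finite^'m::finite" where
  "ones_matrix = (\<chi> i j. 1)"

definition f1 :: "'a::field \<Rightarrow> 'a" where
  "f1 x = x / (1 - x)"

definition f2 :: "'a::field \<Rightarrow> 'a" where
  "f2 x = x / (1 + x)"

end

theory Submission
  imports Defs
begin

text \<open>
  Let \<open>F\<^sub>i\<^sub>j\<close> be the generating function of the nonbacktracking walks that start with the step
  from \<open>i\<close> to \<open>j\<close>. Deleting the first step gives \<open>F\<^sub>i\<^sub>j = t A\<^sub>i\<^sub>j (\<Phi>\<^sub>j - F\<^sub>j\<^sub>i)\<close>; solving this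
  together with the same equation for \<open>F\<^sub>j\<^sub>i\<close> yields
  \<open>(1 - t\<^sup>2 S\<^sub>i\<^sub>j) F\<^sub>i\<^sub>j = t A\<^sub>i\<^sub>j \<Phi>\<^sub>j - t\<^sup>2 S\<^sub>i\<^sub>j \<Phi>\<^sub>i\<close>, and summing over \<open>j\<close> gives \<open>M \<Phi> = I\<close>.
  The series \<open>F\<^sub>i\<^sub>j\<close> converge because the terms of \<open>\<Phi>\<close> tend to zero and the walk counts satisfy
  a linear recursion with nonnegative coefficients, which forces geometric decay.
\<close>

section \<open>Nonbacktracking walks sorted by their first step\<close>

definition nbt_walks_via ::
  "('n \<times> 'n) set \<Rightarrow> nat \<Rightarrow> 'n \<Rightarrow> 'n \<Rightarrow> 'n \<Rightarrow> 'n list set" where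
  "nbt_walks_via E k i j l = {w \<in> nbt_walks E k i l. 1 < length w \<and> w ! 1 = j}"

text \<open>Coefficient of \<open>t ^ k\<close> in the entry with endpoint \<open>l\<close> of the
  row \<open>F\<^sub>i\<^sub>j\<close>.\<close>

definition nbt_via ::
  "('n \<times> 'n) set \<Rightarrow> real^'n^'n \<Rightarrow> nat \<Rightarrow> 'n \<Rightarrow> 'n \<Rightarrow> 'n \<Rightarrow> real" where
  "nbt_via E A k i j l = (\<Sum>w\<in>nbt_walks_via E k i j l. walk_weight A w)"

lemma finite_nbt_walks: "finite (nbt_walks E k i (j::'n::finite))"
proof (rule finite_subset)
  show "nbt_walks E k i j \<subseteq> {w. set w \<subseteq> UNIV \<and> length w = Suc k}"
    by (auto simp: nbt_walks_def is_walk_def)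
qed (rule finite_lists_length_eq, simp)

text \<open>A backtrack in \<open>i # w\<close> either lies inside \<open>w\<close> or starts at the
  new head, and the latter happens exactly when the second node of \<open>w\<close> is again
  \<open>i\<close>.\<close>

lemma nonbacktracking_Cons:
  "nonbacktracking (i # w) \<longleftrightarrow>
     nonbacktracking w \<and> \<not> (1 < length w \<and> w ! 1 = i)"
proof -
  have "(\<exists>j ys. w = j # i # ys) \<longleftrightarrow> 1 < length w \<and> w ! 1 = i"
    by (cases w; cases "tl w") auto
  moreover have "(\<exists>xs ys a b. i # w = xs @ [a, b, a] @ ys) \<longleftrightarrow>
      (\<exists>j ys. w = j # i # ys) \<or> (\<exists>xs ys a b. w = xs @ [a, b, a] @ ys)"
    (is "?P \<longleftrightarrow> ?Q \<or> ?R")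
  proof
    assume ?P
    then obtain xs ys a b where eq: "i # w = xs @ [a, b, a] @ ys" by blast
    show "?Q \<or> ?R"
    proof (cases xs)
      case Nil
      with eq show ?thesis by simp
    next
      case (Cons c cs)
      with eq have "w = cs @ [a, b, a] @ ys" by simp
      then show ?thesis by blast
    qed
  next
    assume "?Q \<or> ?R"
    then show ?P
    proof
      assume ?Q
      then obtain j ys where "w = j # i # ys" by blast
      then have "i # w = [] @ [i, j, i] @ ys" by simp
      then show ?P by blast
    next
      assume ?R
      then obtain xs ys a b where "w = xs @ [a, b, a] @ ys" by blast
      then have "i # w = (i # xs) @ [a, b, a] @ ys" by simp
      then show ?P by blast
    qed
  qed
  ultimately show ?thesis
    unfolding nonbacktracking_def by blast
qed

lemma is_walk_Cons:
  assumes "w \<noteq> []"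
  shows "is_walk E (Suc k) (i # w) \<longleftrightarrow> (i, hd w) \<in> E \<and> is_walk E k w"
proof -
  have "(\<forall>m<Suc k. ((i # w) ! m, (i # w) ! Suc m) \<in> E) \<longleftrightarrow>
        (i, hd w) \<in> E \<and> (\<forall>m<k. (w ! m, w ! Suc m) \<in> E)"
    using assms by (simp add: All_less_Suc2 hd_conv_nth)
  then show ?thesis by (auto simp: is_walk_def)
qed

text \<open>Prepending \<open>i\<close> to a walk from \<open>j\<close> spoils it only if that walk
  steps straight back to \<open>i\<close>. The excluded walks form a class of the same kind with
  \<open>i\<close> and \<open>j\<close> exchanged, so the recursion closes.\<close>

lemma nbt_walks_via_Suc:
  "nbt_walks_via E (Suc k) i j l =
     (if (i, j) \<in> E then (#) i ` (nbt_walks E k j l - nbt_walks_via E k j i l) else {})"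
  (is "?L = ?R")
proof -
  have *: "w \<in> ?L \<longleftrightarrow> (\<exists>v. w = i # v \<and> (i, j) \<in> E \<and> v \<in> nbt_walks E k j l
      \<and> \<not> (1 < length v \<and> v ! 1 = i))" for w
  proof (cases w)
    case Nil
    then show ?thesis by (auto simp: nbt_walks_via_def)
  next
    case (Cons a v)
    show ?thesis
    proof (cases "v = []")
      case True
      with Cons show ?thesis
        by (auto simp: nbt_walks_via_def nbt_walks_def is_walk_def)
    next
      case False
      then show ?thesis
        using is_walk_Cons[OF False, of E k a]
        by (auto simp: Cons nbt_walks_via_def nbt_walks_def nonbacktracking_Cons
              hd_conv_nth[OF False])
    qed
  qed
  show ?thesis
    by (rule set_eqI, subst *) (auto simp: nbt_walks_via_def)
qed

lemma walk_weight_Cons: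
  assumes "w \<noteq> []"
  shows "walk_weight A (i # w) = A $ i $ hd w * walk_weight A w"
  using assms
  by (cases w) (simp_all add: walk_weight_def prod.lessThan_Suc_shift del: prod.lessThan_Suc)

text \<open>The guard \<open>1 < length w\<close> keeps the one-node walk out, so the unspecified
  value \<open>[i] ! 1\<close> never matters.\<close>

lemma nbt_via_0: "nbt_via E A 0 i j l = 0"
  by (auto simp: nbt_via_def nbt_walks_via_def nbt_walks_def is_walk_def intro: sum.neutral)

text \<open>Coefficient form of the first-step equation. For a non-edge both sides vanish, because
  \<open>A\<close> is zero there.\<close>

lemma nbt_via_Suc:
  fixes A :: "real^'n::finite^'n"
  assumes "weighted_adjacency E A"
  shows "nbt_via E A (Suc k) i j l = A $ i $ j * (nbt_matrix E A k $ j $ l - nbt_via E A k j i l)"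
proof (cases "(i, j) \<in> E")
  case True
  let ?D = "nbt_walks E k j l - nbt_walks_via E k j i l"
  have "nbt_via E A (Suc k) i j l = (\<Sum>v\<in>?D. walk_weight A (i # v))"
    using True by (simp add: nbt_via_def nbt_walks_via_Suc sum.reindex)
  also have "\<dots> = (\<Sum>v\<in>?D. A $ i $ j * walk_weight A v)"
  proof (rule sum.cong)
    fix v assume "v \<in> ?D"
    then have "v \<noteq> []" "hd v = j" by (auto simp: nbt_walks_def is_walk_def)
    then show "walk_weight A (i # v) = A $ i $ j * walk_weight A v"
      by (simp add: walk_weight_Cons)
  qed simp
  also have "\<dots> = A $ i $ j * (nbt_matrix E A k $ j $ l - nbt_via E A k j i l)"
    unfolding sum_distrib_left[symmetric] nbt_matrix_def nbt_via_def
    by (subst sum_diff) (auto simp: finite_nbt_walks nbt_walks_via_def)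
  finally show ?thesis .
next
  case False
  with assms show ?thesis
    by (simp add: nbt_via_def nbt_walks_via_Suc weighted_adjacency_def)
qed

lemma nbt_matrix_0: "nbt_matrix E A 0 $ i $ j = (if i = j then 1 else 0)"
proof -
  have "nbt_walks E 0 i j = (if i = j then {[i]} else {})"
    by (auto simp: nbt_walks_def is_walk_def nonbacktracking_def length_Suc_conv)
  then show ?thesis by (simp add: nbt_matrix_def walk_weight_def)
qed

text \<open>A walk of positive length has exactly one second node; the walk of length 0 has none and
  contributes the identity.\<close>

lemma nbt_matrix_eq_sum_via:
  fixes A :: "real^'n::finite^'n"
  shows "nbt_matrix E A k $ i $ l =
    mat (if k = 0 then 1 else 0) $ i $ l + (\<Sum>j\<in>UNIV. nbt_via E A k i j l)"
proof (cases k)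
  case 0
  then show ?thesis by (simp add: nbt_matrix_0 nbt_via_0 mat_def)
next
  case (Suc m)
  have "nbt_walks_via E k i j l = {w \<in> nbt_walks E k i l. w ! 1 = j}" for j
    by (auto simp: nbt_walks_via_def nbt_walks_def is_walk_def Suc)
  then have "(\<Sum>j\<in>UNIV. nbt_via E A k i j l) = (\<Sum>w\<in>nbt_walks E k i l. walk_weight A w)"
    unfolding nbt_via_def by (simp add: sum.group finite_nbt_walks)
  then show ?thesis using Suc by (simp add: nbt_matrix_def mat_def)
qed

section \<open>Convergence of the first-step series\<close>

lemma walk_weight_nonneg: "weighted_adjacency E A \<Longrightarrow> 0 \<le> walk_weight A w"
  unfolding walk_weight_def weighted_adjacency_def
  by (intro prod_nonneg ballI) (metis order.refl less_imp_le)

lemma nbt_via_nonneg: "weighted_adjacency E A \<Longrightarrow> 0 \<le> nbt_via E A k i j l"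
  unfolding nbt_via_def by (intro sum_nonneg walk_weight_nonneg)

lemma nbt_matrix_nonneg: "weighted_adjacency E A \<Longrightarrow> 0 \<le> nbt_matrix E A k $ i $ l"
  by (auto simp: nbt_matrix_def intro!: sum_nonneg walk_weight_nonneg)

lemma nbt_via_le_matrix:
  fixes A :: "real^'n::finite^'n"
  assumes "weighted_adjacency E A"
  shows "nbt_via E A k i j l \<le> nbt_matrix E A k $ i $ l"
  unfolding nbt_via_def nbt_matrix_def
  by (auto simp: nbt_walks_via_def finite_nbt_walks
      intro!: sum_mono2 walk_weight_nonneg[OF assms])

text \<open>A partial sum is at most the sum of the first \<open>K\<close> terms plus half of
  itself, hence at most twice that fixed sum.\<close>

lemma summable_if_shift_le_half:
  fixes f :: "nat \<Rightarrow> real"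
  assumes "\<And>n. 0 \<le> f n" and "\<And>n. f (n + K) \<le> f n / 2"
  shows "summable f"
proof (rule summableI_nonneg_bounded)
  fix n
  have "sum f {..<n} \<le> sum f {..<K + n}"
    using assms(1) by (intro sum_mono2) auto
  also have "\<dots> = sum f {..<K} + (\<Sum>m<n. f (m + K))"
    by (induction n) (simp_all add: add.commute)
  also have "(\<Sum>m<n. f (m + K)) \<le> sum f {..<n} / 2"
    unfolding sum_divide_distrib by (intro sum_mono assms(2))
  finally show "sum f {..<n} \<le> 2 * sum f {..<K}" by simp
qed (rule assms)

text \<open>Null terms alone do not give summability. Here a linear recursion with nonnegative
  coefficients carries one halving of all values to every later length.\<close>

lemma summable_nbt_via:
  fixes A :: "real^'n::finite^'n"
  assumes adj: "weighted_adjacency E A" and r: "0 \<le> r"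
    and lim: "\<And>i l. (\<lambda>k. r ^ k * nbt_matrix E A k $ i $ l) \<longlonglongrightarrow> 0"
  shows "summable (\<lambda>k. r ^ k * nbt_via E A k i j l)"
proof -
  define u where "u k i j = r ^ k * (\<Sum>l\<in>UNIV. nbt_via E A k i j l)" for k i j
  have A0: "0 \<le> A $ i $ j" for i j
    using adj by (metis weighted_adjacency_def less_imp_le order.refl)
  have u0: "0 \<le> u k i j" for k i j
    unfolding u_def using r by (intro mult_nonneg_nonneg sum_nonneg nbt_via_nonneg[OF adj]) auto
  have u_1: "u 1 i j = r * A $ i $ j" for i j
    using nbt_via_Suc[OF adj, of 0]
    by (simp add: u_def nbt_via_0 nbt_matrix_0 flip: sum_distrib_left)
  \<comment> \<open>Summing over the endpoint leaves a recursion on pairs \<open>(i, j)\<close>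
    alone. The subtracted class is the summand \<open>m = i\<close>, so no negative coefficient
    remains. It starts at length 1, since length 0 has no second node to split by.\<close>
  have u_rec: "u (Suc (Suc k)) i j = r * A $ i $ j * (\<Sum>m\<in>UNIV - {i}. u (Suc k) j m)" for k i j
  proof -
    have "u (Suc (Suc k)) i j = r * A $ i $ j *
        (r ^ Suc k * (\<Sum>l\<in>UNIV. nbt_matrix E A (Suc k) $ j $ l - nbt_via E A (Suc k) j i l))"
      unfolding u_def nbt_via_Suc[OF adj, of "Suc k" i j] by (simp add: sum_distrib_left mult_ac)
    also have "(\<Sum>l\<in>UNIV. nbt_matrix E A (Suc k) $ j $ l - nbt_via E A (Suc k) j i l) =
        (\<Sum>l\<in>UNIV. \<Sum>m\<in>UNIV - {i}. nbt_via E A (Suc k) j m l)"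
      by (intro sum.cong refl) (simp add: nbt_matrix_eq_sum_via mat_def sum_diff1)
    also have "\<dots> = (\<Sum>m\<in>UNIV - {i}. \<Sum>l\<in>UNIV. nbt_via E A (Suc k) j m l)"
      by (rule sum.swap)
    finally show ?thesis
      by (simp only: u_def sum_distrib_left)
  qed
  have u_lim: "(\<lambda>k. u k i j) \<longlonglongrightarrow> 0" for i j
  proof (rule tendsto_sandwich[OF _ _ tendsto_const])
    show "\<forall>\<^sub>F k in sequentially. 0 \<le> u k i j" by (simp add: u0)
    show "\<forall>\<^sub>F k in sequentially. u k i j \<le> (\<Sum>l\<in>UNIV. r ^ k * nbt_matrix E A k $ i $ l)"
      unfolding u_def sum_distrib_left using r
      by (intro always_eventually allI sum_mono mult_left_mono nbt_via_le_matrix[OF adj]) auto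
    show "(\<lambda>k. \<Sum>l\<in>UNIV. r ^ k * nbt_matrix E A k $ i $ l) \<longlonglongrightarrow> 0"
      using tendsto_sum[of UNIV "\<lambda>l k. r ^ k * nbt_matrix E A k $ i $ l" "\<lambda>_. 0"] lim by simp
  qed
  \<comment> \<open>If \<open>r * A $ i $ j = 0\<close>, then \<open>u\<close> vanishes at all
    positive lengths; otherwise \<open>u 1 i j\<close> is positive and the null sequence drops below
    its half.\<close>
  have "\<forall>\<^sub>F k in sequentially. u (k + 1) i j \<le> u 1 i j / 2" for i j
  proof (cases "r * A $ i $ j = 0")
    case True
    have "u (k + 1) i j = 0" for k
      using True by (cases k) (simp_all add: u_1[simplified] u_rec)
    then show ?thesis using u0[of 1 i j] by simp
  next
    case False
    then have "0 < u 1 i j / 2" using r A0[of i j] by (simp add: u_1[simplified] less_le)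
    from order_tendstoD(2)[OF LIMSEQ_ignore_initial_segment[OF u_lim[of i j], of 1] this]
    show ?thesis by (rule eventually_mono) simp
  qed
  then have "\<forall>\<^sub>F k in sequentially. \<forall>i j. u (k + 1) i j \<le> u 1 i j / 2"
    by (intro eventually_all_finite)
  then obtain K where K: "u (K + 1) i j \<le> u 1 i j / 2" for i j
    by (auto simp: eventually_sequentially)
  \<comment> \<open>The recursion is monotone, so a bound valid for all pairs at one length passes
    to the next.\<close>
  have decay: "u (Suc (n + K)) i j \<le> u (Suc n) i j / 2" for n i j
  proof (induction n arbitrary: i j)
    case 0
    then show ?case using K by simp
  next
    case (Suc n)
    have "u (Suc (Suc n + K)) i j = r * A $ i $ j * (\<Sum>m\<in>UNIV - {i}. u (Suc (n + K)) j m)"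
      by (simp add: u_rec)
    also have "\<dots> \<le> r * A $ i $ j * (\<Sum>m\<in>UNIV - {i}. u (Suc n) j m / 2)"
      by (intro mult_left_mono sum_mono Suc mult_nonneg_nonneg r A0)
    also have "\<dots> = u (Suc (Suc n)) i j / 2"
      by (simp add: u_rec sum_divide_distrib[symmetric])
    finally show ?case .
  qed
  have "summable (\<lambda>k. u (Suc k) i j)"
    by (rule summable_if_shift_le_half[where K = K]) (rule u0, rule decay)
  then have "summable (\<lambda>k. u k i j)" by (subst (asm) summable_Suc_iff)
  then show ?thesis
  proof (rule summable_comparison_test[rotated], intro exI allI impI)
    fix k
    have "nbt_via E A k i j l \<le> (\<Sum>l\<in>UNIV. nbt_via E A k i j l)"
      by (rule member_le_sum) (simp_all add: nbt_via_nonneg[OF adj])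
    then show "norm (r ^ k * nbt_via E A k i j l) \<le> u k i j"
      using r nbt_via_nonneg[OF adj] by (simp add: u_def abs_mult mult_left_mono)
  qed
qed

section \<open>Generating functions and the inverse\<close>

lemma sums_vec_nth:
  fixes f :: "nat \<Rightarrow> 'a::real_normed_vector^'n::finite"
  shows "f sums s \<Longrightarrow> (\<lambda>k. f k $ i) sums (s $ i)"
  by (rule bounded_linear.sums[OF bounded_linear_vec_nth])

lemma nbt_gen_sums:
  fixes t :: "'a::{real_normed_field,banach}"
  assumes "summable (nbt_term E A t)"
  shows "(\<lambda>k. t ^ k * of_real (nbt_matrix E A k $ i $ l)) sums (nbt_gen E A t $ i $ l)"
  using sums_vec_nth[OF sums_vec_nth[OF summable_sums[OF assms]], of i l]
  unfolding nbt_gen_def by (simp add: nbt_term_def[of E A t k for k] mscale_def map_matrix_def)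

text \<open>Convergence does not keep the denominators nonzero: for a single pair of opposite edges
  the series is a polynomial in \<open>t\<close>. The assumption \<open>defined\<close> restricts to
  those \<open>t\<close> where the entrywise division makes sense.\<close>

theorem theorem3p3:
  fixes E :: "('n::finite \<times> 'n) set"
    and A S Q :: "real^'n^'n"
    and t :: "'a::{real_normed_field,banach}"
    and tQ M :: "'a^'n^'n"
  assumes adj: "weighted_adjacency E A"
    and S: "S = A \<circ>\<^sub>H transpose A"
    and Q: "Q = map_matrix sqrt S"
    and tQ: "tQ = mscale t (map_matrix of_real Q)"
    and M: "M = mat 1 + dd (map_matrix f1 tQ ** map_matrix f2 tQ)
                - mscale t (map_matrix of_real A)
                    \<oslash>\<^sub>H (ones_matrix - mscale (t\<^sup>2) (map_matrix of_real S))"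
    and conv: "summable (nbt_term E A t)"
    and defined: "\<forall>i j. 1 - t\<^sup>2 * of_real (S $ i $ j) \<noteq> 0"
  shows "invertible M \<and> nbt_gen E A t = matrix_inv M"
proof -
  define \<Phi> where "\<Phi> = nbt_gen E A t"
  define F where "F i j l = (\<Sum>k. t ^ k * of_real (nbt_via E A k i j l))" for i j l
  define a where "a i j = t * of_real (A $ i $ j)" for i j
  define s where "s i j = t\<^sup>2 * of_real (S $ i $ j)" for i j
  have s_a: "s i j = a i j * a j i" for i j
    by (simp add: s_def a_def S hadamard_def transpose_def power2_eq_square)
  have s1: "1 - s i j \<noteq> 0" for i j using defined by (simp add: s_def)
  note \<Phi>_sums = nbt_gen_sums[OF conv, folded \<Phi>_def]
  \<comment> \<open>Since the entries of \<open>nbt_matrix\<close> are nonnegative, these are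
    exactly the norms of the terms of \<Phi>.\<close>
  have "(\<lambda>k. norm t ^ k * nbt_matrix E A k $ i $ l) \<longlonglongrightarrow> 0" for i l
    using tendsto_norm_zero[OF summable_LIMSEQ_zero[OF sums_summable[OF \<Phi>_sums[of i l]]]]
    by (simp add: norm_mult norm_power nbt_matrix_nonneg[OF adj])
  note summable_via = summable_nbt_via[OF adj norm_ge_zero this]
  have F_sums: "(\<lambda>k. t ^ k * of_real (nbt_via E A k i j l)) sums F i j l" for i j l
    unfolding F_def
    by (rule summable_sums, rule summable_norm_cancel)
      (simp add: norm_mult norm_power nbt_via_nonneg[OF adj] summable_via)
  have F_rec: "F i j l = a i j * (\<Phi> $ j $ l - F j i l)" for i j l
  proof -
    \<comment> \<open>The shift loses nothing, as the coefficient at length 0 is zero.\<close>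
    have "(\<lambda>k. t ^ Suc k * of_real (nbt_via E A (Suc k) i j l)) sums F i j l"
      using F_sums[of i j l] by (subst sums_Suc_iff) (simp add: nbt_via_0)
    moreover have "t ^ Suc k * of_real (nbt_via E A (Suc k) i j l) = a i j *
        (t ^ k * of_real (nbt_matrix E A k $ j $ l) - t ^ k * of_real (nbt_via E A k j i l))" for k
      by (simp add: nbt_via_Suc[OF adj] a_def algebra_simps)
    ultimately have "(\<lambda>k. a i j * (t ^ k * of_real (nbt_matrix E A k $ j $ l)
        - t ^ k * of_real (nbt_via E A k j i l))) sums F i j l"
      by simp
    from sums_unique2[OF this sums_mult[OF sums_diff[OF \<Phi>_sums F_sums]]]
    show ?thesis .
  qed
  have F_eq: "F i j l = a i j / (1 - s i j) * \<Phi> $ j $ l - s i j / (1 - s i j) * \<Phi> $ i $ l" for i j l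
  proof -
    have "F i j l = a i j * (\<Phi> $ j $ l - a j i * (\<Phi> $ i $ l - F i j l))"
      using F_rec[of i j l] F_rec[of j i l] by simp
    then have "(1 - s i j) * F i j l = a i j * \<Phi> $ j $ l - s i j * \<Phi> $ i $ l"
      by (simp add: s_a algebra_simps)
    then have "F i j l = (a i j * \<Phi> $ j $ l - s i j * \<Phi> $ i $ l) / (1 - s i j)"
      by (metis nonzero_mult_div_cancel_left s1)
    then show ?thesis by (simp add: diff_divide_distrib)
  qed
  have \<Phi>_eq: "\<Phi> $ i $ l = mat 1 $ i $ l + (\<Sum>j\<in>UNIV. F i j l)" for i l
  proof -
    have "(\<lambda>k. (if k = 0 then mat 1 $ i $ l else 0)
        + (\<Sum>j\<in>UNIV. t ^ k * of_real (nbt_via E A k i j l)))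
        sums (mat 1 $ i $ l + (\<Sum>j\<in>UNIV. F i j l))"
      by (intro sums_add sums_sum F_sums sums_single)
    moreover have "t ^ k * of_real (nbt_matrix E A k $ i $ l) = (if k = 0 then mat 1 $ i $ l else 0)
        + (\<Sum>j\<in>UNIV. t ^ k * of_real (nbt_via E A k i j l))" for k
      by (simp add: nbt_matrix_eq_sum_via mat_def sum_distrib_left)
    ultimately show ?thesis using sums_unique2[OF \<Phi>_sums] by simp
  qed
  \<comment> \<open>Symmetry of \<open>Q\<close> gives both factors the same argument
    \<open>x\<close>, so the product is \<open>x\<^sup>2 / (1 - x\<^sup>2)\<close>; nonnegativity of
    \<open>S\<close> turns \<open>x\<^sup>2\<close> into \<open>s i j\<close>.\<close>
  have f12: "f1 (tQ $ i $ j) * f2 (tQ $ j $ i) = s i j / (1 - s i j)" for i j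
  proof -
    have S0: "0 \<le> S $ i $ j" and S_sym: "S $ j $ i = S $ i $ j"
      using adj by (auto simp: S hadamard_def transpose_def weighted_adjacency_def mult.commute)
        (metis less_imp_le mult_nonneg_nonneg order.refl)
    have "tQ $ j $ i = tQ $ i $ j" by (simp add: tQ Q mscale_def map_matrix_def S_sym)
    moreover have "s i j = tQ $ i $ j * tQ $ i $ j"
      using S0 by (simp add: s_def tQ Q mscale_def map_matrix_def power2_eq_square mult_ac
          flip: of_real_mult)
    ultimately show ?thesis by (simp add: f1_def f2_def algebra_simps)
  qed
  have M_nth: "M $ i $ j = (if i = j then 1 + (\<Sum>m\<in>UNIV. s i m / (1 - s i m)) else 0)
      - a i j / (1 - s i j)" for i j
    by (simp add: M dd_def hadamard_div_def ones_matrix_def mat_def matrix_matrix_mult_def f12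
        s_def[symmetric] a_def[symmetric] mscale_def map_matrix_def)
  have "(M ** \<Phi>) $ i $ l = mat 1 $ i $ l" for i l
  proof -
    have "(M ** \<Phi>) $ i $ l = (\<Sum>j\<in>UNIV. M $ i $ j * \<Phi> $ j $ l)"
      by (simp add: matrix_matrix_mult_def)
    also have "\<dots> = \<Phi> $ i $ l + (\<Sum>m\<in>UNIV. s i m / (1 - s i m)) * \<Phi> $ i $ l
        - (\<Sum>j\<in>UNIV. a i j / (1 - s i j) * \<Phi> $ j $ l)"
      by (simp add: M_nth left_diff_distrib sum_subtractf if_distrib[of "\<lambda>x. x * _"]
          distrib_right cong: if_cong)
    also have "\<dots> = \<Phi> $ i $ l - (\<Sum>j\<in>UNIV. F i j l)"
      by (simp add: F_eq sum_subtractf sum_distrib_right)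
    also have "\<dots> = mat 1 $ i $ l"
      using \<Phi>_eq[of i l] by simp
    finally show ?thesis .
  qed
  then have "M ** \<Phi> = mat 1" by (simp add: vec_eq_iff)
  then have inv: "M ** \<Phi> = mat 1" "\<Phi> ** M = mat 1"
    using matrix_left_right_inverse by blast+
  then have "invertible M" by (auto simp: invertible_def)
  moreover have "\<Phi> = matrix_inv M"
  proof -
    \<comment> \<open>\<open>matrix_inv\<close> is a choice among two-sided inverses, and \<Phi>
      witnesses that one exists; uniqueness then identifies the two.\<close>
    have "matrix_inv M ** M = mat 1"
      unfolding matrix_inv_def by (rule someI2[of _ \<Phi>]) (use inv in auto)
    then show ?thesis using inv(1) by (metis matrix_mul_assoc matrix_mul_lid matrix_mul_rid)
  qed
  ultimately show ?thesis by (simp add: \<Phi>_def)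
qed

end
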